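(* Let $n\ge1$, $m\ge2$, and let $H_{n,m}\subset\mathbb{R}^{n^m}$ be the H-cycle polytope, i.e. the set of $y=(y_{i_1\cdots i_m})_{(i_1,\ldots,i_m)\in[n]^m}$ satisfying \[ \sum_{(i_1,\ldots,i_m)\in[n]^m} y_{i_1\cdots i_m}\bigl((m-1)e_{i_1}-e_{i_2}-\cdots-e_{i_m}\bigr)=0,\qquad \sum_{(i_1,\ldots,i_m)\in[n]^m} y_{i_1\cdots i_m}=1,\qquad y_{i_1\cdots i_m}\ge0. \] If $y$ is a vertex of $H_{n,m}$, then for each $j=1,\ldots,n$, $y$ has at most one nonzero entry of the form $y_{j\,i_2\cdots i_m}$ (with first index $j$). Moreover, there exist vertices of $H_{n,m}$ with exactly $n$ nonzero entries.
   Context: $e_1,\ldots,e_n$ denote the standard basis vectors of $\mathbb{R}^n$. *)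

theory Defs
  imports "HOL-Analysis.Analysis"
begin

text \<open>
  Here \<open>[n]\<close> is the index type \<open>'n\<close> and a tuple \<open>(i\<^sub>1, \<dots>, i\<^sub>m)\<close> is a vector of type \<open>'n ^ 'm\<close>, whose
  positions \<open>1, \<dots>, m\<close> are the elements of the finite linearly ordered type \<open>'m\<close>. The order only
  serves to single out the first position. A tensor \<open>y\<close> then has type \<open>real ^ ('n ^ 'm)\<close>.
\<close>

definition first_index :: "'n ^ 'm::{finite,linorder} \<Rightarrow> 'n"
  where "first_index i = i $ Min UNIV"

definition cycle_vector :: "'n::finite ^ 'm::{finite,linorder} \<Rightarrow> real ^ 'n"
  where "cycle_vector i =
    (real CARD('m) - 1) *\<^sub>R axis (first_index i) 1 - (\<Sum>k\<in>UNIV - {Min UNIV}. axis (i $ k) 1)"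

definition H_cycle_polytope :: "(real ^ ('n::finite ^ 'm::{finite,linorder})) set"
  where "H_cycle_polytope =
    {y. (\<Sum>i\<in>UNIV. (y $ i) *\<^sub>R cycle_vector i) = 0 \<and> (\<Sum>i\<in>UNIV. y $ i) = 1 \<and> (\<forall>i. 0 \<le> y $ i)}"

end

theory Submission
  imports Defs
begin

text \<open>
  Let \<open>y\<close> be a vertex with support \<open>T\<close>, and let \<open>S\<close> be the set of first indices of \<open>T\<close>. Comparing the
  coordinates outside \<open>S\<close> of the balance equation shows that the cycle vectors of \<open>T\<close> lie in
  \<open>\<real>\<^sup>S\<close>. They also have coordinate sum zero, so for any \<open>j0\<close> in \<open>S\<close> the equations defining the
  polytope are encoded, on tensors supported in \<open>T\<close>, by the single vector
  \<open>\<Sum>i. y\<^sub>i (cycle_vector i + e\<^bsub>j0\<^esub>)\<close> of \<open>\<real>\<^sup>S\<close>. As \<open>y\<close> is a vertex, this map is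
  injective, whence \<open>card T \<le> card S\<close>, and so \<open>T\<close> has one element for each element of \<open>S\<close>.

  For existence, take a cyclic permutation \<open>\<sigma>\<close> of \<open>[n]\<close> and give each tuple
  \<open>(j, \<sigma> j, \<dots>, \<sigma> j)\<close> the weight \<open>1/n\<close>; the balance equation forces all weights on these tuples
  to be equal.
\<close>

section \<open>Coordinates of cycle vectors\<close>

lemma sum_cycle_vector:
  fixes i :: "'n::finite ^ 'm::{finite,linorder}"
  shows "(\<Sum>k\<in>UNIV. cycle_vector i $ k) = 0"
proof -
  have ax: "(\<Sum>k\<in>UNIV. axis a (1::real) $ k) = 1" for a :: 'n
    by (simp add: axis_def)
  have "(\<Sum>k\<in>UNIV. \<Sum>l\<in>UNIV - {Min UNIV}. axis (i $ l) (1::real) $ k) = real CARD('m) - 1"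
    by (subst sum.swap) (simp add: ax of_nat_diff Suc_leI)
  moreover have "(\<Sum>k\<in>UNIV. (real CARD('m) - 1) * axis (first_index i) 1 $ k) = real CARD('m) - 1"
    by (simp add: sum_distrib_left[symmetric] ax)
  ultimately show ?thesis
    by (simp add: cycle_vector_def sum_subtractf)
qed

text \<open>The only positive contribution to a cycle vector sits at the first index.\<close>

lemma cycle_vector_nonpos:
  fixes i :: "'n::finite ^ 'm::{finite,linorder}"
  assumes "first_index i \<noteq> k"
  shows "cycle_vector i $ k \<le> 0"
proof -
  have "0 \<le> (\<Sum>l\<in>UNIV - {Min UNIV}. axis (i $ l) (1::real) $ k)"
    by (intro sum_nonneg) (simp add: axis_def)
  then show ?thesis
    using assms by (simp add: cycle_vector_def axis_def)
qed

text \<open>At a coordinate \<open>k\<close> that is no first index of the support, all terms of the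
  balance equation are nonpositive. They add up to zero, so each of them vanishes.\<close>

lemma cycle_vector_eq_0:
  fixes y :: "real ^ ('n::finite ^ 'm::{finite,linorder})"
  assumes y: "y \<in> H_cycle_polytope" and i: "y $ i \<noteq> 0"
    and k: "k \<notin> first_index ` {i. y $ i \<noteq> 0}"
  shows "cycle_vector i $ k = 0"
proof -
  have nonneg: "- (y $ l * cycle_vector l $ k) \<ge> 0" for l
  proof (cases "y $ l = 0")
    case False
    then have "cycle_vector l $ k \<le> 0"
      using k by (intro cycle_vector_nonpos) auto
    then show ?thesis
      using y by (auto simp: H_cycle_polytope_def mult_nonneg_nonpos)
  qed simp
  have "(\<Sum>l\<in>UNIV. (y $ l) *\<^sub>R cycle_vector l) $ k = 0"
    using y by (simp add: H_cycle_polytope_def)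
  then have "(\<Sum>l\<in>UNIV. - (y $ l * cycle_vector l $ k)) = 0"
    by (simp add: sum_negf)
  then have "- (y $ i * cycle_vector i $ k) = 0"
    using nonneg by (subst (asm) sum_nonneg_eq_0_iff) auto
  then show ?thesis
    using i by simp
qed

section \<open>Support of a vertex\<close>

text \<open>Otherwise a small multiple of \<open>d\<close> could be both added to and subtracted
  from \<open>y\<close> inside the polytope, making \<open>y\<close> a midpoint of two distinct
  points of it.\<close>

lemma extreme_point_perturbation_zero:
  fixes y d :: "real ^ ('n::finite ^ 'm::{finite,linorder})"
  assumes y: "y extreme_point_of H_cycle_polytope"
    and supp: "\<And>i. y $ i = 0 \<Longrightarrow> d $ i = 0"
    and bal: "(\<Sum>i\<in>UNIV. (d $ i) *\<^sub>R cycle_vector i) = 0"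
    and tot: "(\<Sum>i\<in>UNIV. d $ i) = 0"
  shows "d = 0"
proof (rule ccontr)
  assume "d \<noteq> 0"
  define T where "T = {i. y $ i \<noteq> 0}"
  \<comment> \<open>With this scaling \<open>e * norm d\<close> is the smallest positive entry of
    \<open>y\<close>, so a shift by \<open>e *\<^sub>R d\<close> in either direction keeps all
    entries nonnegative.\<close>
  define e where "e = Min (($) y ` T) / norm d"
  have yH: "y \<in> H_cycle_polytope"
    using y by (simp add: extreme_point_of_def)
  have "T \<noteq> {}"
    using supp \<open>d \<noteq> 0\<close> by (auto simp: T_def vec_eq_iff)
  then have "Min (($) y ` T) \<in> ($) y ` T"
    by (intro Min_in) auto
  then have "Min (($) y ` T) > 0"
    using yH by (auto simp: H_cycle_polytope_def T_def less_le)
  then have "e > 0"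
    using \<open>d \<noteq> 0\<close> by (simp add: e_def)
  have bound: "\<bar>e * d $ i\<bar> \<le> y $ i" for i
  proof (cases "i \<in> T")
    case True
    have "\<bar>e * d $ i\<bar> \<le> e * norm d"
      using \<open>e > 0\<close> component_le_norm_cart[of d i] by (simp add: abs_mult)
    also have "\<dots> = Min (($) y ` T)"
      using \<open>d \<noteq> 0\<close> by (simp add: e_def)
    also have "\<dots> \<le> y $ i"
      using True by simp
    finally show ?thesis .
  qed (use supp in \<open>simp add: T_def\<close>)
  have mem: "y + c *\<^sub>R d \<in> H_cycle_polytope" if "\<bar>c\<bar> = e" for c
  proof -
    have "(\<Sum>i\<in>UNIV. ((y + c *\<^sub>R d) $ i) *\<^sub>R cycle_vector i)
        = (\<Sum>i\<in>UNIV. (y $ i) *\<^sub>R cycle_vector i) + c *\<^sub>R (\<Sum>i\<in>UNIV. (d $ i) *\<^sub>R cycle_vector i)"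
      by (simp add: scaleR_add_left sum.distrib scaleR_sum_right)
    moreover have "(\<Sum>i\<in>UNIV. (y + c *\<^sub>R d) $ i) = (\<Sum>i\<in>UNIV. y $ i) + c * (\<Sum>i\<in>UNIV. d $ i)"
      by (simp add: sum.distrib sum_distrib_left)
    moreover have "0 \<le> (y + c *\<^sub>R d) $ i" for i
      using bound[of i] that by (auto simp: abs_mult abs_if split: if_splits)
    ultimately show ?thesis
      using yH bal tot by (simp add: H_cycle_polytope_def)
  qed
  have "y \<in> open_segment (y + e *\<^sub>R d) (y + (- e) *\<^sub>R d)"
  proof -
    have "y + e *\<^sub>R d - (y + (- e) *\<^sub>R d) = (2 * e) *\<^sub>R d"
      by (simp add: algebra_simps flip: scaleR_add_left)
    then have "y + e *\<^sub>R d \<noteq> y + (- e) *\<^sub>R d"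
      using \<open>e > 0\<close> \<open>d \<noteq> 0\<close>
      by (metis eq_iff_diff_eq_0 less_numeral_extra(3) mult_eq_0_iff scaleR_eq_0_iff zero_neq_numeral)
    moreover have "y = (1 - 1 / 2) *\<^sub>R (y + e *\<^sub>R d) + (1 / 2) *\<^sub>R (y + (- e) *\<^sub>R d)"
      by (simp add: vec_eq_iff field_simps)
    ultimately show ?thesis
      unfolding in_segment by (intro conjI exI[of _ "1 / 2"]) auto
  qed
  moreover have "y + e *\<^sub>R d \<in> H_cycle_polytope" "y + (- e) *\<^sub>R d \<in> H_cycle_polytope"
    using \<open>e > 0\<close> by (auto intro!: mem simp del: scaleR_minus_left)
  ultimately show False
    using y unfolding extreme_point_of_def by blast
qed

lemma first_index_inj_on_support:
  fixes y :: "real ^ ('n::finite ^ 'm::{finite,linorder})"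
  assumes y: "y extreme_point_of H_cycle_polytope"
  shows "inj_on first_index {i. y $ i \<noteq> 0}"
proof -
  define T where "T = {i. y $ i \<noteq> 0}"
  define S where "S = first_index ` T"
  have yH: "y \<in> H_cycle_polytope"
    using y by (simp add: extreme_point_of_def)
  have "T \<noteq> {}"
  proof
    assume "T = {}"
    then have "(\<Sum>i\<in>UNIV. y $ i) = 0"
      by (intro sum.neutral) (auto simp: T_def)
    then show False
      using yH by (simp add: H_cycle_polytope_def)
  qed
  then obtain j0 where j0: "j0 \<in> S"
    by (auto simp: S_def)
  \<comment> \<open>The added \<open>axis j0 1\<close> stores the total of \<open>d\<close>: cycle
    vectors have coordinate sum zero, so the coordinates of \<open>L d\<close> sum to that total.
    Taking \<open>j0\<close> in \<open>S\<close> keeps the image of \<open>V\<close> inside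
    \<open>W\<close>.\<close>
  define L :: "real ^ ('n, 'm) vec \<Rightarrow> real ^ 'n"
    where "L d = (\<Sum>i\<in>UNIV. (d $ i) *\<^sub>R (cycle_vector i + axis j0 1))" for d
  define V where "V = {d :: real ^ ('n, 'm) vec. \<forall>i. i \<notin> T \<longrightarrow> d $ i = 0}"
  define W where "W = {v :: real ^ 'n. \<forall>k. k \<notin> S \<longrightarrow> v $ k = 0}"
  have L: "L d = (\<Sum>i\<in>UNIV. (d $ i) *\<^sub>R cycle_vector i) + (\<Sum>i\<in>UNIV. d $ i) *\<^sub>R axis j0 1" for d
    by (simp add: L_def scaleR_add_right sum.distrib scaleR_sum_left)
  have lin: "linear L"
    unfolding L_def
    by (intro linearI) (simp_all add: scaleR_add_left sum.distrib scaleR_sum_right del: scaleR_add_right)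
  have subV: "subspace V"
    by (auto simp: V_def subspace_def)
  have inj: "inj_on L V"
  proof (subst linear_injective_on_subspace_0[OF lin subV], intro ballI impI)
    fix d assume d: "d \<in> V" and Ld: "L d = 0"
    \<comment> \<open>Summing all coordinates recovers the total of \<open>d\<close>; once it is
      zero, \<open>L d = 0\<close> reduces to the balance equation.\<close>
    have "(\<Sum>k\<in>UNIV. L d $ k) = (\<Sum>k\<in>UNIV. \<Sum>i\<in>UNIV. d $ i * cycle_vector i $ k)
        + (\<Sum>k\<in>UNIV. (\<Sum>i\<in>UNIV. d $ i) * axis j0 1 $ k)"
      by (simp add: L sum.distrib)
    also have "(\<Sum>k\<in>UNIV. \<Sum>i\<in>UNIV. d $ i * cycle_vector i $ k) = 0"
      by (subst sum.swap) (simp add: sum_distrib_left[symmetric] sum_cycle_vector)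
    also have "(\<Sum>k\<in>UNIV. (\<Sum>i\<in>UNIV. d $ i) * axis j0 1 $ k) = (\<Sum>i\<in>UNIV. d $ i)"
      by (simp add: axis_def flip: sum_distrib_left)
    finally have tot: "(\<Sum>i\<in>UNIV. d $ i) = 0"
      by (simp add: Ld)
    then have "(\<Sum>i\<in>UNIV. (d $ i) *\<^sub>R cycle_vector i) = 0"
      using Ld by (simp add: L)
    with tot d show "d = 0"
      by (intro extreme_point_perturbation_zero[OF y]) (auto simp: V_def T_def)
  qed
  have "L ` V \<subseteq> W"
  proof
    fix v assume "v \<in> L ` V"
    then obtain d where d: "d \<in> V" and v: "v = L d"
      by blast
    have "d $ i * (cycle_vector i + axis j0 1) $ k = 0" if "k \<notin> S" for i k
    proof (cases "i \<in> T")
      case True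
      then have "cycle_vector i $ k = 0"
        using that by (intro cycle_vector_eq_0[OF yH]) (auto simp: T_def S_def)
      then show ?thesis
        using that j0 by (auto simp: axis_def)
    qed (use d in \<open>simp add: V_def\<close>)
    then show "v \<in> W"
      by (auto simp: v W_def L_def intro!: sum.neutral)
  qed
  have "card T = dim V"
    unfolding V_def by (simp add: dim_substandard_cart flip: dim_vec_eq)
  also have "\<dots> = dim (L ` V)"
    using dim_image_eq[OF lin, of V] inj subV by (simp add: span_eq_iff[THEN iffD2])
  also have "\<dots> \<le> dim W"
    by (rule dim_subset) fact
  also have "\<dots> = card S"
    unfolding W_def by (simp add: dim_substandard_cart flip: dim_vec_eq)
  finally have "card (first_index ` T) = card T"
    unfolding S_def using card_image_le[of T first_index] by simp
  then show ?thesis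
    unfolding T_def by (intro eq_card_imp_inj_on) auto
qed

section \<open>A vertex from a cyclic permutation\<close>

text \<open>This tuple acts as an arc from \<open>j\<close> to \<open>\<sigma> j\<close>: its cycle
  vector is a multiple of the difference of the two basis vectors.\<close>

definition step_tuple :: "('n \<Rightarrow> 'n) \<Rightarrow> 'n \<Rightarrow> 'n ^ 'm::{finite,linorder}"
  where "step_tuple \<sigma> j = (\<chi> k. if k = Min UNIV then j else \<sigma> j)"

lemma first_index_step_tuple [simp]: "first_index (step_tuple \<sigma> j) = j"
  by (simp add: first_index_def step_tuple_def)

lemma inj_step_tuple: "inj (step_tuple \<sigma>)"
  by (rule inj_on_inverseI[where g = first_index]) simp

lemma cycle_vector_step_tuple:
  fixes \<sigma> :: "'n::finite \<Rightarrow> 'n"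
  shows "cycle_vector (step_tuple \<sigma> j :: 'n ^ 'm::{finite,linorder})
    = (real CARD('m) - 1) *\<^sub>R (axis j 1 - axis (\<sigma> j) 1)"
proof -
  have "(\<Sum>k\<in>UNIV - {Min UNIV :: 'm}. axis ((step_tuple \<sigma> j :: ('n, 'm) vec) $ k) (1::real))
      = (\<Sum>k\<in>UNIV - {Min UNIV :: 'm}. axis (\<sigma> j) 1)"
    by (intro sum.cong) (auto simp: step_tuple_def)
  also have "\<dots> = (real CARD('m) - 1) *\<^sub>R axis (\<sigma> j) 1"
    by (simp add: sum_constant_scaleR of_nat_diff Suc_leI del: sum_constant)
  finally show ?thesis
    by (simp add: cycle_vector_def scaleR_diff_right)
qed

lemma sum_over_step_tuples:
  fixes g :: "'n::finite ^ 'm::{finite,linorder} \<Rightarrow> 'a::comm_monoid_add"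
  assumes "\<And>i. i \<notin> range (step_tuple \<sigma>) \<Longrightarrow> g i = 0"
  shows "(\<Sum>i\<in>UNIV. g i) = (\<Sum>j\<in>UNIV. g (step_tuple \<sigma> j))"
proof -
  have "(\<Sum>i\<in>UNIV. g i) = (\<Sum>i\<in>range (step_tuple \<sigma>). g i)"
    using assms by (intro sum.mono_neutral_right) auto
  then show ?thesis
    by (simp add: sum.reindex inj_step_tuple)
qed

text \<open>Only the arc leaving \<open>\<sigma> l\<close> and, by injectivity, the single arc
  entering it from \<open>l\<close> contribute. Reading the balance at \<open>\<sigma> l\<close>
  avoids the inverse of \<open>\<sigma>\<close>.\<close>

lemma balance_step_tuples:
  fixes a :: "real ^ ('n::finite ^ 'm::{finite,linorder})"
  assumes "\<And>i. i \<notin> range (step_tuple \<sigma>) \<Longrightarrow> a $ i = 0" and "inj \<sigma>"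
  shows "(\<Sum>i\<in>UNIV. (a $ i) *\<^sub>R cycle_vector i) $ \<sigma> l
    = (real CARD('m) - 1) * (a $ step_tuple \<sigma> (\<sigma> l) - a $ step_tuple \<sigma> l)"
proof -
  have "(\<Sum>i\<in>UNIV. (a $ i) *\<^sub>R cycle_vector i) $ \<sigma> l
      = (\<Sum>j\<in>UNIV. (a $ step_tuple \<sigma> j) *\<^sub>R cycle_vector (step_tuple \<sigma> j :: ('n, 'm) vec)) $ \<sigma> l"
    using assms(1) by (subst sum_over_step_tuples[where \<sigma> = \<sigma>]) auto
  also have "\<dots> = (\<Sum>j\<in>UNIV. (real CARD('m) - 1) *
      ((if \<sigma> l = j then a $ step_tuple \<sigma> j else 0) - (if l = j then a $ step_tuple \<sigma> j else 0)))"
    using injD[OF \<open>inj \<sigma>\<close>]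
    by (auto simp: cycle_vector_step_tuple axis_def intro!: sum.cong)
  also have "\<dots> = (real CARD('m) - 1) * (a $ step_tuple \<sigma> (\<sigma> l) - a $ step_tuple \<sigma> l)"
    by (simp add: sum_distrib_left[symmetric] sum_subtractf)
  finally show ?thesis .
qed

text \<open>The permutation is one cycle through all of \<open>'n\<close>. Its transitivity is
  stated as constancy of invariant functions, the form in which it is applied to the
  weights.\<close>

lemma exists_cyclic_bijection:
  obtains \<sigma> :: "'n::finite \<Rightarrow> 'n"
  where "bij \<sigma>" and "\<And>(x :: 'n \<Rightarrow> 'a) j k. (\<And>l. x (\<sigma> l) = x l) \<Longrightarrow> x j = x k"
proof -
  define N where "N = CARD('n)"
  have "N > 0"
    by (simp add: N_def)
  obtain f :: "nat \<Rightarrow> 'n" where f: "bij_betw f {0..<N} UNIV"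
    using ex_bij_betw_nat_finite[of "UNIV :: 'n set"] by (auto simp: N_def)
  define g where "g = inv_into {0..<N} f"
  have gf: "g (f k) = k" if "k < N" for k
    using f that by (simp add: g_def bij_betw_inv_into_left)
  have fg: "f (g j) = j" "g j < N" for j
    using f bij_betw_inv_into_right[OF f, of j] inv_into_into[of j f "{0..<N}"]
    by (auto simp: g_def bij_betw_def)
  define \<sigma> where "\<sigma> j = f (Suc (g j) mod N)" for j
  have "surj \<sigma>"
  proof (rule surjI)
    fix j
    \<comment> \<open>Adding \<open>N - 1\<close> modulo \<open>N\<close> is the cyclic predecessor,
      also when \<open>g j = 0\<close>.\<close>
    show "\<sigma> (f ((g j + (N - 1)) mod N)) = j"
      using \<open>N > 0\<close> fg[of j] by (simp add: \<sigma>_def gf mod_Suc_eq)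
  qed
  then have "bij \<sigma>"
    by (simp add: bij_def finite_UNIV_surj_inj)
  moreover have "x j = x k" if x: "\<And>l. x (\<sigma> l) = x l" for x :: "'n \<Rightarrow> 'a" and j k
  proof -
    have "x (f l) = x (f 0)" if "l < N" for l
      using that
    proof (induction l)
      case (Suc l)
      then have "\<sigma> (f l) = f (Suc l)"
        by (simp add: \<sigma>_def gf)
      then show ?case
        using x[of "f l"] Suc by simp
    qed simp
    from this[of "g j"] this[of "g k"] show ?thesis
      by (simp add: fg)
  qed
  ultimately show thesis
    by (rule that)
qed

text \<open>The uniform weight \<open>y\<close> on the arcs is the only point of the polytope
  vanishing off \<open>T\<close>. Endpoints of a segment with \<open>y\<close> in its interior also
  vanish off \<open>T\<close>, so both would equal \<open>y\<close>.\<close>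

lemma extreme_point_card_support:
  assumes "2 \<le> CARD('m::{finite,linorder})"
  shows "\<exists>y. y extreme_point_of (H_cycle_polytope :: (real ^ ('n::finite ^ 'm::{finite,linorder})) set) \<and>
    card {i. y $ i \<noteq> 0} = CARD('n)"
proof -
  obtain \<sigma> :: "'n \<Rightarrow> 'n" where "bij \<sigma>"
    and const: "\<And>(x :: 'n \<Rightarrow> real) j k. (\<And>l. x (\<sigma> l) = x l) \<Longrightarrow> x j = x k"
    using exists_cyclic_bijection by metis
  then have "inj \<sigma>" "surj \<sigma>"
    by (auto simp: bij_def)
  define T :: "('n, 'm) vec set" where "T = range (step_tuple \<sigma>)"
  define y :: "real ^ ('n, 'm) vec" where "y = (\<chi> i. if i \<in> T then 1 / real CARD('n) else 0)"
  have supp: "{i. y $ i \<noteq> 0} = T"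
    by (auto simp: y_def)
  have yH: "y \<in> H_cycle_polytope"
  proof -
    have "(\<Sum>i\<in>UNIV. (y $ i) *\<^sub>R cycle_vector i) $ k = 0" for k
    proof -
      obtain l where "k = \<sigma> l"
        using \<open>surj \<sigma>\<close> by blast
      then show ?thesis
        using balance_step_tuples[of \<sigma> y l] \<open>inj \<sigma>\<close> by (simp add: y_def T_def)
    qed
    moreover have "(\<Sum>i\<in>UNIV. y $ i) = 1"
      by (subst sum_over_step_tuples[where \<sigma> = \<sigma>]) (auto simp: y_def T_def)
    ultimately show ?thesis
      by (simp add: H_cycle_polytope_def vec_eq_iff y_def)
  qed
  have unique: "a = y" if a: "a \<in> H_cycle_polytope" and zero: "\<And>i. i \<notin> T \<Longrightarrow> a $ i = 0" for a
  proof -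
    have "a $ step_tuple \<sigma> (\<sigma> l) = a $ step_tuple \<sigma> l" for l
    proof -
      have "(real CARD('m) - 1) * (a $ step_tuple \<sigma> (\<sigma> l) - a $ step_tuple \<sigma> l) = 0"
        using a zero \<open>inj \<sigma>\<close> unfolding H_cycle_polytope_def T_def
        by (subst balance_step_tuples[symmetric]) (auto simp: vec_eq_iff)
      \<comment> \<open>The factor \<open>real CARD('m) - 1\<close> is nonzero because
        \<open>2 \<le> CARD('m)\<close>.\<close>
      then show ?thesis
        using assms by auto
    qed
    then have eq: "a $ step_tuple \<sigma> j = a $ step_tuple \<sigma> k" for j k
      by (rule const[of "\<lambda>j. a $ step_tuple \<sigma> j"])
    have val: "a $ step_tuple \<sigma> k = 1 / real CARD('n)" for k
    proof -
      have "1 = (\<Sum>i\<in>UNIV. a $ i)"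
        using a by (simp add: H_cycle_polytope_def)
      also have "\<dots> = (\<Sum>j\<in>UNIV. a $ step_tuple \<sigma> j)"
        using zero by (intro sum_over_step_tuples) (simp add: T_def)
      also have "\<dots> = (\<Sum>j\<in>(UNIV :: 'n set). a $ step_tuple \<sigma> k)"
        by (intro sum.cong eq refl)
      finally show ?thesis
        by (simp add: field_simps)
    qed
    show "a = y"
      using zero val by (auto simp: vec_eq_iff y_def T_def)
  qed
  have "y \<notin> open_segment a b" if a: "a \<in> H_cycle_polytope" and b: "b \<in> H_cycle_polytope" for a b
  proof
    assume "y \<in> open_segment a b"
    then obtain u where "a \<noteq> b" and u: "0 < u" "u < 1" and y: "y = (1 - u) *\<^sub>R a + u *\<^sub>R b"
      by (auto simp: in_segment)
    \<comment> \<open>Off \<open>T\<close> a combination of nonnegative entries with positive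
      weights is zero, which forces both entries to be zero.\<close>
    have zero: "a $ i = 0 \<and> b $ i = 0" if "i \<notin> T" for i
    proof -
      have "(1 - u) * a $ i + u * b $ i = 0"
        using that arg_cong[OF y, of "\<lambda>v. v $ i"] supp by auto
      moreover have "0 \<le> a $ i" "0 \<le> b $ i"
        using a b by (auto simp: H_cycle_polytope_def)
      ultimately show ?thesis
        using u by (simp add: add_nonneg_eq_0_iff)
    qed
    then have "a = y" "b = y"
      using unique a b by blast+
    with \<open>a \<noteq> b\<close> show False
      by simp
  qed
  then have "y extreme_point_of H_cycle_polytope"
    using yH by (simp add: extreme_point_of_def)
  moreover have "card {i. y $ i \<noteq> 0} = CARD('n)"
    unfolding supp T_def by (simp add: card_image inj_step_tuple)
  ultimately show ?thesis
    by blast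
qed

theorem theorem4:
  assumes "2 \<le> CARD('m::{finite,linorder})"
  shows "(\<forall>y. y extreme_point_of (H_cycle_polytope :: (real ^ ('n::finite ^ 'm::{finite,linorder})) set) \<longrightarrow>
            (\<forall>j. card {i. first_index i = j \<and> y $ i \<noteq> 0} \<le> 1)) \<and>
         (\<exists>y. y extreme_point_of (H_cycle_polytope :: (real ^ ('n::finite ^ 'm::{finite,linorder})) set) \<and>
            card {i. y $ i \<noteq> 0} = CARD('n))"
proof (intro conjI allI impI)
  fix y :: "real ^ ('n, 'm) vec" and j
  assume "y extreme_point_of H_cycle_polytope"
  then have "inj_on first_index {i. y $ i \<noteq> 0}"
    by (rule first_index_inj_on_support)
  then show "card {i. first_index i = j \<and> y $ i \<noteq> 0} \<le> 1"
    unfolding One_nat_def by (subst card_le_Suc0_iff_eq) (auto dest: inj_onD)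
qed (rule extreme_point_card_support[OF assms])

end
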